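(* Let $n>2$ be an even integer. Then for every integer $m\ge0$ every pole of $I_m(s)$ is simple and is located at a point of the form $s=-\frac n2-1-k$ with $k\ge0$ an integer. Hence $\mathcal{W}_r^d=\emptyset$ for every integer $r>1$.
   Context: $(a)_\ell=a(a+1)\cdots(a+\ell-1)$ is the Pochhammer symbol, $(a)_0=1$, and ${}_2F_1$ is the Gauss hypergeometric function. For integers $n>2$ and $m\ge0$ put $$S_m(t)=\frac{(n-1)_m}{(\frac n2)_m}\,{}_2F_1\!\left(\begin{matrix}m,\ 1-\frac n2\\ m+\frac n2\end{matrix};t\right),$$ and for $s>-1$ (or $\operatorname{Re}s>-1$) $$I_m(s)=\frac{\Gamma(\frac n2+s+1)}{\Gamma(\frac n2)\,\Gamma(s+1)}\int_0^1t^{m+\frac n2-1}(1-t)^sS_m(t)^2\,dt.$$ The function $I_m$ extends to a meromorphic function on $\mathbb{C}$, still denoted $I_m(s)$. For $s_0\in\mathbb{C}$ and an integer $r\ge1$, let $c_{-r,m}(s_0)$ be the coefficient of $(s-s_0)^{-r}$ in the Laurent expansion of $I_m$ at $s_0$. The discrete Wallach set $\mathcal{W}_r^d$ (depending on $n$) is the set of $s_0\in\mathbb{C}$ such that $I_m$ has a pole at $s_0$ for some $m$, the numbers $c_{-r,m}(s_0)$, $m\ge0$, are either all nonnegative or all nonpositive, and they are not all zero. *)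

theory Defs
  imports "HOL-Complex_Analysis.Complex_Analysis"
begin

definition hyp2F1 :: "real \<Rightarrow> real \<Rightarrow> real \<Rightarrow> real \<Rightarrow> real" where
  "hyp2F1 a b c t = eval_fps (fps_hypergeo [a, b] [c] 1) t"

lemma hyp2F1_altdef:
  "hyp2F1 a b c t = (\<Sum>k. pochhammer a k * pochhammer b k / (pochhammer c k * fact k) * t ^ k)"
  by (simp add: hyp2F1_def eval_fps_def)

definition S :: "nat \<Rightarrow> nat \<Rightarrow> real \<Rightarrow> real" where
  "S n m t = pochhammer (real n - 1) m / pochhammer (real n / 2) m
     * hyp2F1 (real m) (1 - real n / 2) (real m + real n / 2) t"

text \<open>The integral formula, meaningful for \<open>Re s > -1\<close>.\<close>

definition I_half_plane :: "nat \<Rightarrow> nat \<Rightarrow> complex \<Rightarrow> complex" where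
  "I_half_plane n m s =
     Gamma (of_nat n / 2 + s + 1) / (Gamma (of_nat n / 2) * Gamma (s + 1))
     * (LBINT t:{0<..<1}. of_real (t powr (real m + real n / 2 - 1))
          * of_real (1 - t) powr s * of_real ((S n m t)\<^sup>2))"

text \<open>
  The meromorphic continuation to the whole plane. The predicate
  \<open>nicely_meromorphic_on\<close> fixes the value 0 at poles and excludes removable
  discontinuities, so that by the identity theorem at most one function qualifies.
\<close>

definition I_mero :: "nat \<Rightarrow> nat \<Rightarrow> complex \<Rightarrow> complex" where
  "I_mero n m = (THE f. f nicely_meromorphic_on UNIV \<and>
                        (\<forall>s. Re s > -1 \<longrightarrow> f s = I_half_plane n m s))"

definition laurent_coeff :: "nat \<Rightarrow> nat \<Rightarrow> nat \<Rightarrow> complex \<Rightarrow> complex" where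
  "laurent_coeff n r m s0 = fls_nth (laurent_expansion (I_mero n m) s0) (- int r)"

text \<open>
  \<open>\<real>\<^sub>\<ge>\<^sub>0\<close> and \<open>\<real>\<^sub>\<le>\<^sub>0\<close> are sets of complex numbers here, so
  membership includes being real.
\<close>

definition discrete_Wallach_set :: "nat \<Rightarrow> nat \<Rightarrow> complex set" where
  "discrete_Wallach_set n r =
     {s0. (\<exists>m. is_pole (I_mero n m) s0) \<and>
          ((\<forall>m. laurent_coeff n r m s0 \<in> \<real>\<^sub>\<ge>\<^sub>0) \<or> (\<forall>m. laurent_coeff n r m s0 \<in> \<real>\<^sub>\<le>\<^sub>0)) \<and>
          \<not> (\<forall>m. laurent_coeff n r m s0 = 0)}"

end

theory Submission
  imports Defs
begin

text \<open>
  For \<open>n = 2 p\<close> the hypergeometric series in \<open>S n m\<close> terminates, so \<open>S n m\<close> squared is a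
  polynomial and the integral is a finite combination of Beta integrals. The Gamma factor in front
  cancels all but the tail of the Pochhammer symbols in their denominators, which leaves
  \<open>\<Sum>j\<le>d. c j / pochhammer (s + 1 + p) (m + j)\<close>. Each denominator has simple zeros
  only, all of the form \<open>- p - 1 - k\<close>.
\<close>

section \<open>Beta integrals with a complex exponent\<close>

lemma continuous_on_of_real_power_times_powr:
  assumes "A \<subseteq> {..<1}"
  shows "continuous_on A (\<lambda>t::real. complex_of_real (t ^ a) * of_real (1 - t) powr s)"
  using assms by (intro continuous_intros) auto

text \<open>Since Re (s + 1) > 0, the antiderivative is continuous up to t = 1 and vanishes there,
  so the fundamental theorem applies although the integrand may be unbounded near 1.\<close>

lemma has_integral_one_minus_powr:
  assumes "Re s > -1"
  shows "((\<lambda>t::real. complex_of_real (1 - t) powr s) has_integral 1 / (s + 1)) {0..1}"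
proof -
  from assms have [simp]: "s + 1 \<noteq> 0" by (auto simp: complex_eq_iff)
  have "((\<lambda>t::real. complex_of_real (1 - t) powr s) has_integral
          (\<lambda>t. - (complex_of_real (1 - t) powr (s + 1) / (s + 1))) 1 -
          (\<lambda>t. - (complex_of_real (1 - t) powr (s + 1) / (s + 1))) 0) {0..1}"
  proof (rule fundamental_theorem_of_calculus_interior)
    show "continuous_on {0..1} (\<lambda>t::real. - (complex_of_real (1 - t) powr (s + 1) / (s + 1)))"
      using assms by (intro continuous_intros) auto
  next
    fix t :: real assume t: "t \<in> {0<..<1}"
    have "((\<lambda>z. - ((1 - z) powr (s + 1) / (s + 1))) has_field_derivative
            (1 - of_real t) powr s) (at (complex_of_real t))"
      using t by (auto intro!: derivative_eq_intros simp: complex_nonpos_Reals_iff)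
    from has_vector_derivative_real_field[OF this]
    show "((\<lambda>t::real. - (complex_of_real (1 - t) powr (s + 1) / (s + 1))) has_vector_derivative
            complex_of_real (1 - t) powr s) (at t)"
      by simp
  qed auto
  thus ?thesis by simp
qed

text \<open>The factor \<open>t ^ a\<close> is at most 1, which reduces everything to a = 0. There
  the norm of the integrand is the real power of 1 - t with exponent Re s, integrable by the
  explicit antiderivative.\<close>

lemma set_integrable_beta:
  assumes "Re s > -1"
  shows "set_integrable lborel {0<..<1}
           (\<lambda>t::real. complex_of_real (t ^ a) * of_real (1 - t) powr s)"
proof -
  let ?f = "\<lambda>t::real. complex_of_real (1 - t) powr s"
  have "(\<lambda>t::real. complex_of_real (1 - t) powr of_real (Re s)) integrable_on {0..1}"
    using has_integral_one_minus_powr[of "of_real (Re s)"] assms by (auto simp: integrable_on_def)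
  hence "(\<lambda>t. Re (complex_of_real (1 - t) powr of_real (Re s))) integrable_on {0..1}"
    using integrable_linear[OF _ bounded_linear_Re] by (simp add: o_def)
  hence "(\<lambda>t. norm (?f t)) integrable_on {0..1}"
    by (rule integrable_eq) (auto simp: powr_of_real norm_powr_real_powr simp flip: of_real_diff)
  moreover have "?f integrable_on {0..1}"
    using has_integral_one_minus_powr[OF assms] by (auto simp: integrable_on_def)
  ultimately have "?f absolutely_integrable_on {0..1}"
    by (simp add: absolutely_integrable_on_def)
  hence "?f absolutely_integrable_on {0<..<1}"
    by (rule set_integrable_subset) auto
  \<comment> \<open>Absolute integrability refers to the completed measure; Borel measurability
    brings it back to \<open>lborel\<close>. On the open interval 1 - t stays off the branch cut, so
    the integrand is continuous there.\<close>
  moreover have meas: "(\<lambda>t::real. indicat_real {0<..<1} t *\<^sub>R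
      (complex_of_real (t ^ b) * of_real (1 - t) powr s)) \<in> borel_measurable borel" for b
    by (intro borel_measurable_continuous_on_indicator continuous_on_of_real_power_times_powr) auto
  ultimately have int: "set_integrable lborel {0<..<1} ?f"
    using meas[of 0] by (simp add: set_integrable_def integrable_completion)
  show ?thesis
  proof (rule set_integrable_bound[OF int])
    show "set_borel_measurable lborel {0<..<1}
            (\<lambda>t. complex_of_real (t ^ a) * complex_of_real (1 - t) powr s)"
      using meas[of a] by (simp add: set_borel_measurable_def)
    show "AE t in lborel. t \<in> {0<..<1} \<longrightarrow>
            norm (complex_of_real (t ^ a) * complex_of_real (1 - t) powr s) \<le> norm (?f t)"
      by (auto simp: norm_mult norm_power intro!: mult_left_le_one_le power_le_one)
  qed
qed

text \<open>For a natural number a the Beta value B(a + 1, s + 1) is rational in s, and induction on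
  a gives it without Gamma identities. The exponent s is generalized because the step needs both s
  and s + 1.\<close>

lemma set_integral_beta:
  assumes "Re s > -1"
  shows "(LBINT t:{0<..<1}. complex_of_real (t ^ a) * of_real (1 - t) powr s) =
           fact a / pochhammer (s + 1) (Suc a)"
  using assms
proof (induction a arbitrary: s)
  case 0
  have "(LBINT t:{0<..<1}. complex_of_real (t ^ 0) * of_real (1 - t) powr s) =
          integral {0<..<1} (\<lambda>t. complex_of_real (t ^ 0) * of_real (1 - t) powr s)"
    by (rule set_borel_integral_eq_integral(2)[OF set_integrable_beta]) fact
  also have "\<dots> = integral {0..1} (\<lambda>t. complex_of_real (1 - t) powr s)"
    by (simp add: integral_open_interval_real)
  also have "\<dots> = 1 / (s + 1)"
    using has_integral_one_minus_powr[OF 0] by (rule integral_unique)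
  finally show ?case by simp
next
  case (Suc a)
  have nz: "s + 1 + of_nat k \<noteq> 0" for k
    using Suc.prems by (auto simp: complex_eq_iff)
  have nz': "pochhammer (s + 1) k \<noteq> 0" for k
    unfolding pochhammer_eq_0_iff using nz by (metis add.left_inverse)
  \<comment> \<open>Expanding \<open>t = 1 - (1 - t)\<close> lowers \<open>a\<close> and raises \<open>s\<close>.\<close>
  have "(LBINT t:{0<..<1}. complex_of_real (t ^ Suc a) * of_real (1 - t) powr s) =
        (LBINT t:{0<..<1}. complex_of_real (t ^ a) * of_real (1 - t) powr s -
            complex_of_real (t ^ a) * of_real (1 - t) powr (s + 1))"
    by (intro set_lebesgue_integral_cong) (auto simp: powr_add algebra_simps)
  also have "\<dots> = fact a / pochhammer (s + 1) (Suc a) - fact a / pochhammer (s + 1 + 1) (Suc a)"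
  proof -
    have s': "Re (s + 1) > -1" using Suc.prems by simp
    show ?thesis
      by (subst set_integral_diff(2)[OF set_integrable_beta[OF Suc.prems] set_integrable_beta[OF s']])
         (simp only: Suc.IH[OF Suc.prems] Suc.IH[OF s'])
  qed
  also have "pochhammer (s + 1 + 1) (Suc a) = pochhammer (s + 1) (Suc (Suc a)) / (s + 1)"
    using nz[of 0] by (subst (2) pochhammer_rec) auto
  also have "fact a / pochhammer (s + 1) (Suc a) -
               fact a / (pochhammer (s + 1) (Suc (Suc a)) / (s + 1)) =
             fact (Suc a) / pochhammer (s + 1) (Suc (Suc a))"
  proof -
    \<comment> \<open>Here x is the last factor of the longer Pochhammer symbol and y = s + 1 its
      first, so x - y is \<open>Suc a\<close>, the factor that completes the factorial.\<close>
    have "A / P - A / (P * x / y) = (x - y) * A / (P * x)"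
      if "P \<noteq> 0" "x \<noteq> 0" for A P x y :: complex
      using that by (simp add: divide_simps) (simp add: algebra_simps)
    from this[OF nz'[of "Suc a"] nz[of "Suc a"], of "fact a" "s + 1"] show ?thesis
      by (simp add: pochhammer_Suc[of _ "Suc a"])
  qed
  finally show ?case .
qed

section \<open>Reduction of the integral to reciprocal Pochhammer symbols\<close>

text \<open>With n = 2 p the second upper parameter is the nonpositive integer 1 - p, so its
  Pochhammer symbol contains the factor 0 from index p on.\<close>

lemma S_polynomial:
  assumes "p > 0"
  obtains P where "\<And>t. S (2 * p) m t = poly P t"
proof -
  define c where "c k = pochhammer (real m) k * pochhammer (1 - real p) k /
                          (pochhammer (real m + real p) k * fact k)" for k
  have "c k = 0" if "k \<ge> p" for k
  proof -
    have "pochhammer (- real (p - 1)) k = 0"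
      using that assms by (intro pochhammer_of_nat_eq_0_lemma) auto
    thus ?thesis using assms by (simp add: c_def of_nat_diff)
  qed
  hence "hyp2F1 (real m) (1 - real p) (real m + real p) t = (\<Sum>k<p. c k * t ^ k)" for t
    unfolding hyp2F1_altdef c_def[symmetric] by (intro suminf_finite) auto
  hence "S (2 * p) m t = poly (smult (pochhammer (real (2 * p) - 1) m / pochhammer (real p) m)
           (\<Sum>k<p. monom (c k) k)) t" for t
    by (simp add: S_def poly_sum poly_monom)
  thus ?thesis by (rule that)
qed

text \<open>Explicit candidate for the meromorphic continuation, used with w = 1 + p. Division by
  zero gives it arbitrary values at its poles, so it is compared on punctured neighbourhoods only
  and normalized later by \<open>remove_sings\<close>.\<close>

definition pochhammer_sum :: "(nat \<Rightarrow> complex) \<Rightarrow> nat \<Rightarrow> nat \<Rightarrow> complex \<Rightarrow> complex \<Rightarrow> complex" where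
  "pochhammer_sum c d m w s = (\<Sum>j\<le>d. c j / pochhammer (s + w) (m + j))"

lemma I_half_plane_eq_pochhammer_sum:
  assumes p: "p > 0"
  obtains c d where
    "\<And>s. Re s > -1 \<Longrightarrow> I_half_plane (2 * p) m s = pochhammer_sum c d m (1 + of_nat p) s"
proof -
  obtain P where P: "\<And>t. S (2 * p) m t = poly P t"
    using S_polynomial[OF p] by blast
  define Q where "Q = P ^ 2"
  have Q: "(S (2 * p) m t)\<^sup>2 = poly Q t" for t
    by (simp add: P Q_def)
  \<comment> \<open>Everything independent of s: the coefficient of the squared polynomial, the
    factorial from the Beta integral and the constant Gamma value in the prefactor.\<close>
  define c where "c j = complex_of_real (coeff Q j) * fact (m + p - 1 + j) / Gamma (of_nat p)"
    for j :: nat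
  have "I_half_plane (2 * p) m s = pochhammer_sum c (degree Q) m (1 + of_nat p) s"
    if s: "Re s > -1" for s
  proof -
    let ?a = "m + p - 1"
    have nz: "s + 1 + of_nat k \<noteq> 0" for k
      using s by (auto simp: complex_eq_iff)
    have nz': "pochhammer (s + 1) k \<noteq> 0" for k
      unfolding pochhammer_eq_0_iff using nz by (metis add.left_inverse)
    have nonpos: "s + 1 \<notin> \<int>\<^sub>\<le>\<^sub>0"
      using nz by (metis add.left_inverse nonpos_Ints_cases')
    have "(LBINT t:{0<..<1}. of_real (t powr (real m + real (2 * p) / 2 - 1))
            * of_real (1 - t) powr s * of_real ((S (2 * p) m t)\<^sup>2)) =
          (LBINT t:{0<..<1}. (\<Sum>j\<le>degree Q. of_real (coeff Q j) *
              (of_real (t ^ (?a + j)) * of_real (1 - t) powr s)))"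
    proof (intro set_lebesgue_integral_cong allI impI)
      fix t :: real assume t: "t \<in> {0<..<1}"
      have "t powr (real m + real (2 * p) / 2 - 1) = t powr real ?a"
        using p by (intro arg_cong[of _ _ "\<lambda>x. t powr x"]) (simp add: of_nat_diff)
      also have "\<dots> = t ^ ?a" using t by (subst powr_realpow) auto
      finally show "of_real (t powr (real m + real (2 * p) / 2 - 1))
            * of_real (1 - t) powr s * of_real ((S (2 * p) m t)\<^sup>2) =
            (\<Sum>j\<le>degree Q. of_real (coeff Q j) *
              (of_real (t ^ (?a + j)) * of_real (1 - t) powr s))"
        by (simp only: Q poly_altdef of_real_sum sum_distrib_left)
           (simp add: power_add algebra_simps)
    qed auto
    also have "\<dots> = (\<Sum>j\<le>degree Q. of_real (coeff Q j) *
                        (fact (?a + j) / pochhammer (s + 1) (Suc (?a + j))))"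
    proof -
      have "integrable lborel (\<lambda>t. indicator {0<..<1} t *\<^sub>R (of_real (coeff Q j) *
              (complex_of_real (t ^ (?a + j)) * of_real (1 - t) powr s)))" for j
        using set_integrable_beta[OF s] unfolding set_integrable_def[symmetric]
        by (rule set_integrable_mult_right)
      thus ?thesis
        unfolding set_lebesgue_integral_def scaleR_sum_right
        by (subst Bochner_Integration.integral_sum)
           (simp_all only: set_integral_mult_right set_integral_beta[OF s] flip: set_lebesgue_integral_def)
    qed
    finally have *: "(LBINT t:{0<..<1}. of_real (t powr (real m + real (2 * p) / 2 - 1))
            * of_real (1 - t) powr s * of_real ((S (2 * p) m t)\<^sup>2)) = \<dots>" .
    have "Gamma (of_nat p + s + 1) = pochhammer (s + 1) p * Gamma (s + 1)"
      using pochhammer_Gamma[OF nonpos, of p] nonpos by (simp add: Gamma_eq_zero_iff add_ac)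
    hence **: "Gamma (of_nat p + s + 1) / (Gamma (of_nat p) * Gamma (s + 1)) =
                 pochhammer (s + 1) p / Gamma (of_nat p)"
      using nonpos by (simp add: Gamma_eq_zero_iff)
    have half: "complex_of_nat (2 * p) / 2 = of_nat p" by simp
    \<comment> \<open>The first p factors, with zeros -1, ..., -p, are exactly those supplied by the
      Gamma quotient; after cancellation the possible poles start at -p - 1.\<close>
    have "pochhammer (s + 1) (Suc (?a + j)) =
          pochhammer (s + 1) p * pochhammer (s + 1 + of_nat p) (m + j)" for j
    proof -
      have "Suc (?a + j) = p + (m + j)" using p by simp
      thus ?thesis by (simp only: pochhammer_product')
    qed
    thus ?thesis
      unfolding I_half_plane_def pochhammer_sum_def c_def * half **
      using nz'[of p] by (simp add: sum_distrib_left add.assoc)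
  qed
  thus ?thesis by (rule that)
qed

section \<open>Poles of sums of reciprocal Pochhammer symbols\<close>

lemma analytic_pochhammer_sum:
  assumes "\<And>k. s0 \<noteq> - w - of_nat k"
  shows "pochhammer_sum c d m w analytic_on {s0}"
proof -
  have "s0 + w + of_nat i \<noteq> 0" for i
    using assms[of i] by (auto simp: algebra_simps eq_neg_iff_add_eq_0)
  thus ?thesis
    unfolding pochhammer_sum_def[abs_def] pochhammer_prod
    by (intro analytic_intros) auto
qed

text \<open>The linear factors of a Pochhammer symbol have distinct zeros, so at most one vanishes
  at s0, and one factor s - s0 clears all denominators at once. Regular points are covered too, as g
  may vanish at s0.\<close>

lemma pochhammer_sum_simple_pole:
  obtains g where "g analytic_on {s0}"
    "eventually (\<lambda>s. pochhammer_sum c d m w s = g s / (s - s0)) (at s0)"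
proof (cases "\<exists>k::nat. s0 = - w - of_nat k")
  case False
  hence "(\<lambda>s. pochhammer_sum c d m w s * (s - s0)) analytic_on {s0}"
    by (intro analytic_intros analytic_pochhammer_sum) auto
  moreover have "eventually (\<lambda>s. pochhammer_sum c d m w s =
      pochhammer_sum c d m w s * (s - s0) / (s - s0)) (at s0)"
    by (auto simp: eventually_at_filter)
  ultimately show ?thesis by (rule that)
next
  case True
  then obtain k :: nat where k: "s0 = - w - of_nat k" by blast
  \<comment> \<open>The denominator without its factor of index k, the one vanishing at s0. For N
    \<le> k there is no such factor, and the \<open>of_bool\<close> exponent in g compensates with
    an extra s - s0.\<close>
  define h where "h N s = (\<Prod>i\<in>{..<N} - {k}. s + w + of_nat i)" for N s
  define g where "g s = (\<Sum>j\<le>d. c j * (s - s0) ^ of_bool (m + j \<le> k) / h (m + j) s)" for s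
  have "h N s0 \<noteq> 0" for N
    by (auto simp: h_def k)
  hence "g analytic_on {s0}"
    unfolding g_def[abs_def] h_def by (intro analytic_intros) auto
  moreover have "pochhammer_sum c d m w s = g s / (s - s0)" if "s \<noteq> s0" for s
  proof -
    have "c j / pochhammer (s + w) N = c j * (s - s0) ^ of_bool (N \<le> k) / h N s / (s - s0)" for j N
    proof (cases "k < N")
      case True
      hence "pochhammer (s + w) N = (s + w + of_nat k) * h N s"
        unfolding pochhammer_prod h_def by (subst prod.remove[of _ k]) (auto simp: atLeast0LessThan)
      also have "s + w + of_nat k = s - s0" by (simp add: k)
      finally show ?thesis using True by simp
    next
      case False
      hence "pochhammer (s + w) N = h N s"
        unfolding pochhammer_prod h_def by (auto intro!: prod.cong)
      thus ?thesis using False that by simp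
    qed
    thus ?thesis
      unfolding pochhammer_sum_def g_def sum_divide_distrib by simp
  qed
  hence "eventually (\<lambda>s. pochhammer_sum c d m w s = g s / (s - s0)) (at s0)"
    by (auto simp: eventually_at_filter)
  ultimately show ?thesis by (rule that)
qed

section \<open>Uniqueness of the normalized meromorphic continuation\<close>

text \<open>By the identity theorem the difference vanishes near every point, except perhaps at the
  point itself. There the normalization decides: the value is 0 at a pole and the limit
  elsewhere.\<close>

lemma nicely_meromorphic_eqI:
  assumes f: "f nicely_meromorphic_on UNIV" and g: "g nicely_meromorphic_on UNIV"
  assumes eq: "eventually (\<lambda>s. f s = g s) (at z0)"
  shows "f = g"
proof
  fix z
  have mf: "f meromorphic_on UNIV" and mg: "g meromorphic_on UNIV"
    using f g by (auto simp: nicely_meromorphic_on_def)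
  have mh: "(\<lambda>s. f s - g s) meromorphic_on UNIV"
    using mf mg by (intro meromorphic_intros)
  hence iso: "isolated_singularity_at (\<lambda>s. f s - g s) w" for w
    by (metis UNIV_I meromorphic_on_isolated_singularity meromorphic_on_subset subset_UNIV)
  \<comment> \<open>The plain difference need not be nicely meromorphic: two poles may cancel and
    leave a limit different from the value 0 - 0.\<close>
  define h where "h = remove_sings (\<lambda>s. f s - g s)"
  have "eventually (\<lambda>s. h s = 0) (at z0)"
    using eventually_remove_sings_eq_at[OF iso] eq unfolding h_def by eventually_elim simp
  hence "frequently (\<lambda>s. h s = 0) (at z0)"
    by (intro eventually_frequently) auto
  hence h0: "h w = 0" for w
    using frequently_eq_meromorphic_imp_constant[of h 0 z0 UNIV]
      remove_sings_nicely_meromorphic[OF mh] by (auto simp: h_def)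
  have ev: "eventually (\<lambda>s. f s = g s) (at z)"
    using eventually_remove_sings_eq_at[OF iso[of z]] h0 unfolding h_def[symmetric]
    by (auto elim: eventually_mono)
  show "f z = g z"
  proof (cases "is_pole f z")
    case True
    moreover from this have "is_pole g z"
      using is_pole_cong[OF ev refl] by simp
    moreover have "u z = 0" if "is_pole u z" "u nicely_meromorphic_on UNIV" for u
      using that not_tendsto_and_filterlim_at_infinity[of "at z" u "u z"]
      unfolding nicely_meromorphic_on_def is_pole_def by auto
    ultimately show ?thesis using f g by metis
  next
    case False
    moreover from this have "\<not> is_pole g z"
      using is_pole_cong[OF ev refl] by simp
    ultimately have "f \<midarrow>z\<rightarrow> f z" "g \<midarrow>z\<rightarrow> g z"
      using f g unfolding nicely_meromorphic_on_def by auto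
    thus ?thesis using tendsto_cong[OF ev] tendsto_unique[of "at z" f] by auto
  qed
qed

section \<open>Laurent expansions and identification of \<open>I_mero\<close>\<close>

text \<open>Dividing the Taylor series of g by s - s0 shifts exponents down by one, so none below -1
  occurs.\<close>

lemma laurent_expansion_simple_pole:
  assumes g: "g analytic_on {s0}" and ev: "eventually (\<lambda>s. f s = g s / (s - s0)) (at s0)"
  shows "(\<lambda>s. f (s0 + s)) has_laurent_expansion
           fps_to_fls (fps_expansion g s0) * fls_X_inv"
proof -
  have "(\<lambda>s. g (s0 + s)) has_laurent_expansion fps_to_fls (fps_expansion g s0)"
    using analytic_at_imp_has_fps_expansion[OF g] by (rule has_laurent_expansion_fps)
  from has_laurent_expansion_mult[OF this has_laurent_expansion_fls_X_inv]
  have "(\<lambda>s. g (s0 + s) * inverse s) has_laurent_expansion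
          fps_to_fls (fps_expansion g s0) * fls_X_inv" .
  also have "?this \<longleftrightarrow> ?thesis"
  proof (rule has_laurent_expansion_cong)
    have "eventually (\<lambda>s. f (s0 + s) = g (s0 + s) / s) (at 0)"
      using ev by (subst (asm) at_to_0) (simp add: eventually_filtermap add_ac)
    thus "eventually (\<lambda>s. g (s0 + s) * inverse s = f (s0 + s)) (at 0)"
      by eventually_elim (simp add: field_simps)
  qed auto
  finally show ?thesis .
qed

text \<open>All possible poles have real part at most -1 - p, so \<open>remove_sings\<close> changes
  nothing on the half plane; it only enforces the normalization that makes the continuation
  unique.\<close>

lemma I_mero_eq:
  assumes I: "\<And>s. Re s > -1 \<Longrightarrow> I_half_plane (2 * p) m s = pochhammer_sum c d m (1 + of_nat p) s"
  shows "I_mero (2 * p) m = remove_sings (pochhammer_sum c d m (1 + of_nat p))"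
proof -
  let ?f = "pochhammer_sum c d m (1 + of_nat p)"
  let ?F = "remove_sings ?f"
  have "?f meromorphic_on UNIV"
    unfolding meromorphic_on_def
    by (metis pochhammer_sum_simple_pole laurent_expansion_simple_pole)
  hence F: "?F nicely_meromorphic_on UNIV"
    by (rule remove_sings_nicely_meromorphic)
  have eq: "?F s = I_half_plane (2 * p) m s" if "Re s > -1" for s
  proof -
    have "?f analytic_on {s}"
      using that by (intro analytic_pochhammer_sum) (auto simp: complex_eq_iff)
    thus ?thesis using I[OF that] by simp
  qed
  show ?thesis
    unfolding I_mero_def
  proof (rule the_equality)
    fix f assume f: "f nicely_meromorphic_on UNIV \<and> (\<forall>s. Re s > -1 \<longrightarrow> f s = I_half_plane (2 * p) m s)"
    \<comment> \<open>The point 0 is interior to the half plane, where both functions equal the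
      integral formula, and so can start the identity theorem.\<close>
    have "eventually (\<lambda>s. Re s > -1) (nhds 0)"
      by (intro eventually_nhds_in_open[of "{s. Re s > -1}", simplified] open_halfspace_Re_gt) auto
    hence "eventually (\<lambda>s. f s = ?F s) (at 0)"
      using f eq by (auto simp: eventually_at_filter elim!: eventually_mono)
    thus "f = ?F"
      using f F nicely_meromorphic_eqI by blast
  qed (use F eq in auto)
qed

section \<open>Order and location of the poles, and the discrete Wallach set\<close>

theorem mainTheorem4:
  fixes n :: nat
  assumes "n > 2" and "even n"
  shows "(\<forall>m s0. is_pole (I_mero n m) s0 \<longrightarrow>
            zorder (I_mero n m) s0 = -1 \<and> (\<exists>k::nat. s0 = - (of_nat n / 2) - 1 - of_nat k))
         \<and> (\<forall>r>1. discrete_Wallach_set n r = {})"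
proof -
  from assms obtain p where n: "n = 2 * p" and p: "p > 0" by (auto elim!: evenE)
  have "\<exists>c d. I_mero n m = remove_sings (pochhammer_sum c d m (1 + of_nat p))" for m
    unfolding n by (metis I_half_plane_eq_pochhammer_sum[OF p] I_mero_eq)
  then obtain c d where I:
      "\<And>m. I_mero n m = remove_sings (pochhammer_sum (c m) (d m) m (1 + of_nat p))"
    by metis
  have expansion: "\<exists>F. (\<lambda>s. I_mero n m (s0 + s)) has_laurent_expansion F \<and>
                       (\<forall>i < -1. fls_nth F i = 0)" for m s0
  proof -
    obtain g where g: "g analytic_on {s0}"
        "eventually (\<lambda>s. pochhammer_sum (c m) (d m) m (1 + of_nat p) s = g s / (s - s0)) (at s0)"
      by (rule pochhammer_sum_simple_pole)
    note L = laurent_expansion_simple_pole[OF g]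
    \<comment> \<open>Isolatedness transfers the expansion to \<open>remove_sings\<close>, which
      agrees with the sum on a punctured neighbourhood.\<close>
    have "isolated_singularity_at (pochhammer_sum (c m) (d m) m (1 + of_nat p)) s0"
      using has_laurent_expansion_isolated[OF L] .
    with L show ?thesis
      by (intro exI[of _ "fps_to_fls (fps_expansion g s0) * fls_X_inv"])
         (auto simp: I fls_X_inv_times_conv_shift)
  qed
  have "zorder (I_mero n m) s0 = -1" if "is_pole (I_mero n m) s0" for m s0
  proof -
    obtain F where F: "(\<lambda>s. I_mero n m (s0 + s)) has_laurent_expansion F"
        "\<And>i. i < -1 \<Longrightarrow> fls_nth F i = 0"
      using expansion by blast
    \<comment> \<open>A pole forces a negative order, and the expansion allows none below
      -1.\<close>
    have neg: "fls_subdegree F < 0"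
      using has_laurent_expansion_imp_is_pole_iff[OF F(1)] that by simp
    hence nz: "F \<noteq> 0" by auto
    have "fls_subdegree F \<ge> -1"
      using F(2) nz by (intro fls_subdegree_geI) auto
    with neg have "fls_subdegree F = -1" by simp
    with has_laurent_expansion_zorder[OF F(1) nz] show ?thesis by simp
  qed
  moreover have "\<exists>k::nat. s0 = - (of_nat n / 2) - 1 - of_nat k" if "is_pole (I_mero n m) s0" for m s0
  proof (rule ccontr)
    assume *: "\<not> ?thesis"
    \<comment> \<open>Here w = 1 + p = n/2 + 1, so the zeros of the denominators are among the
      listed points.\<close>
    have "s0 \<noteq> - (1 + of_nat p) - of_nat k" for k
      using * by (auto simp: n)
    hence ana: "pochhammer_sum (c m) (d m) m (1 + of_nat p) analytic_on {s0}"
      by (rule analytic_pochhammer_sum)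
    hence "\<not> is_pole (I_mero n m) s0"
      using isolated_singularity_at_analytic[OF ana] analytic_at_imp_no_pole[OF ana] by (simp add: I)
    with that show False by contradiction
  qed
  \<comment> \<open>This holds at every point and for all m, contradicting the nonvanishing clause
    of the Wallach set.\<close>
  moreover have "laurent_coeff n r m s0 = 0" if "r > 1" for r m s0
  proof -
    obtain F where F: "(\<lambda>s. I_mero n m (s0 + s)) has_laurent_expansion F"
        "\<And>i. i < -1 \<Longrightarrow> fls_nth F i = 0"
      using expansion by blast
    show ?thesis
      using F(2)[of "- int r"] laurent_expansion_eqI[OF F(1)] that by (simp add: laurent_coeff_def)
  qed
  ultimately show ?thesis by (auto simp: discrete_Wallach_set_def)
qed

end
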